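(* Consider a single-query quantum algorithm on $n$ qubits, with unitaries $V,W$ and initial state $|\psi_0\rangle$, for an oracle classification problem $(\mathcal F,\{A_j\}_{j\in\mathcal J},\{U_f\},\{p_f\})$, in which the first $k\le n$ qubits are measured in the computational basis at the end, with outcome $Y\in\{0,1\}^k$. Let $\rho_Y$ be the pre-measurement state averaged over the oracle, reduced to the $k$ measured qubits. Then $H(Y)\ge S(\rho_Y)$, and consequently $$I(J;Y)\ \ge\ S(\rho_Y)-H(Y\mid J).$$
   Context: Oracle classification problem: a finite set $\mathcal F$; a partition $\mathcal F=\bigsqcup_{j\in\mathcal J}A_j$ into nonempty classes; a unitary $U_f$ on $m\le n$ qubits for each $f$ (acting as $U_f\otimes I$ on $n$ qubits); and a probability distribution $p_f=\Pr(F=f)$. $J$ is the class of $F$. With $T_f=W(U_f\otimes I)V$, $$\rho_Y=\mathrm{Tr}_{N}\Bigl(\sum_{f\in\mathcal F}p_fT_f|\psi_0\rangle\langle\psi_0|T_f^\dagger\Bigr),$$ where $\mathrm{Tr}_N$ traces out the $n-k$ non-measured qubits. Given $F=f$, $\Pr(Y=y\mid F=f)=\langle y|\mathrm{Tr}_N(T_f|\psi_0\rangle\langle\psi_0|T_f^\dagger)|y\rangle$; in particular $\Pr(Y=y)=\langle y|\rho_Y|y\rangle$. $H$ denotes Shannon entropy, $H(Y\mid J)$ conditional Shannon entropy, $I(J;Y)=H(Y)-H(Y\mid J)$ mutual information, and $S$ von Neumann entropy, all with base-2 logarithms. *)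

theory Defs
  imports
    "HOL-Probability.Information"
    "Jordan_Normal_Form.Schur_Decomposition"
begin

text \<open>
  The Hilbert space of \<open>n\<close> qubits has dimension \<open>2 ^ n\<close>. Its computational basis
  is indexed by the numbers below \<open>2 ^ n\<close>, a bit string standing for the number that it
  represents in binary with the first qubit as the most significant bit. In particular, a
  measurement outcome in \<open>{0,1}\<^sup>k\<close> is a number below \<open>2 ^ k\<close>.
\<close>

definition unitary_on :: "nat \<Rightarrow> complex mat \<Rightarrow> bool" where
  "unitary_on N U \<longleftrightarrow>
     U \<in> carrier_mat N N \<and> mat_adjoint U * U = 1\<^sub>m N \<and> U * mat_adjoint U = 1\<^sub>m N"

definition kronecker :: "complex mat \<Rightarrow> complex mat \<Rightarrow> complex mat" where
  "kronecker A B =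
     Matrix.mat (dim_row A * dim_row B) (dim_col A * dim_col B)
       (\<lambda>(i, j). A $$ (i div dim_row B, j div dim_col B) * B $$ (i mod dim_row B, j mod dim_col B))"

definition mat_trace :: "complex mat \<Rightarrow> complex" where
  "mat_trace A = (\<Sum>i<dim_row A. A $$ (i, i))"

definition projector :: "complex Matrix.vec \<Rightarrow> complex mat" where
  "projector \<psi> = mat_of_cols (dim_vec \<psi>) [\<psi>] * mat_adjoint (mat_of_cols (dim_vec \<psi>) [\<psi>])"

text \<open>Partial trace of an operator on \<open>\<complex>\<^sup>a \<otimes> \<complex>\<^sup>b\<close> over the second factor.\<close>

definition partial_trace :: "nat \<Rightarrow> nat \<Rightarrow> complex mat \<Rightarrow> complex mat" where
  "partial_trace a b A =
     Matrix.mat a a (\<lambda>(i, j). \<Sum>l<b. A $$ (i * b + l, j * b + l))"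

text \<open>Functional calculus of a Hermitian matrix \<open>A = U D U\<^sup>\<dagger>\<close>, with \<open>U\<close> unitary
  and \<open>D\<close> real diagonal: \<open>f(A) = U f(D) U\<^sup>\<dagger>\<close>. Lemma \<open>hermitian_fun_eq\<close> below shows that the
  choice of \<open>U\<close> and \<open>D\<close> is immaterial.\<close>

definition hermitian_fun :: "(real \<Rightarrow> real) \<Rightarrow> complex mat \<Rightarrow> complex mat" where
  "hermitian_fun f A =
     (SOME B. \<exists>U d. unitary_on (dim_row A) U \<and>
        A = U * mat_diag (dim_row A) (\<lambda>i. complex_of_real (d i)) * mat_adjoint U \<and>
        B = U * mat_diag (dim_row A) (\<lambda>i. complex_of_real (f (d i))) * mat_adjoint U)"

lemma mat_adjoint_carrier:
  "U \<in> carrier_mat n m \<Longrightarrow> mat_adjoint U \<in> carrier_mat m n"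
  by (auto simp: mat_adjoint_def)

lemma hermitian_fun_unique:
  assumes U: "unitary_on N U" and V: "unitary_on N V"
    and eq: "U * mat_diag N (\<lambda>i. complex_of_real (d i)) * mat_adjoint U =
             V * mat_diag N (\<lambda>i. complex_of_real (e i)) * mat_adjoint V"
  shows "U * mat_diag N (\<lambda>i. complex_of_real (f (d i))) * mat_adjoint U =
         V * mat_diag N (\<lambda>i. complex_of_real (f (e i))) * mat_adjoint V"
proof -
  let ?D = "\<lambda>g. mat_diag N (\<lambda>i. complex_of_real (g (d i)))"
  let ?E = "\<lambda>g. mat_diag N (\<lambda>i. complex_of_real (g (e i)))"
  let ?U = "mat_adjoint U" and ?V = "mat_adjoint V"
  define W where "W = ?V * U"
  have c: "U \<in> carrier_mat N N" "V \<in> carrier_mat N N" "?U \<in> carrier_mat N N" "?V \<in> carrier_mat N N"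
    "?D g \<in> carrier_mat N N" "?E g \<in> carrier_mat N N" for g
    using U V by (auto simp: unitary_on_def mat_adjoint_carrier)
  have u: "?U * U = 1\<^sub>m N" "U * ?U = 1\<^sub>m N" "?V * V = 1\<^sub>m N" "V * ?V = 1\<^sub>m N"
    using U V by (auto simp: unitary_on_def)
  have W: "W \<in> carrier_mat N N" unfolding W_def using c by auto
  have assoc: "A * B * C = A * (B * C)"
    if "A \<in> carrier_mat N N" "B \<in> carrier_mat N N" "C \<in> carrier_mat N N" for A B C :: "complex mat"
    using that by (rule assoc_mult_mat)
  have mc: "A * B \<in> carrier_mat N N"
    if "A \<in> carrier_mat N N" "B \<in> carrier_mat N N" for A B :: "complex mat"
    using that by auto
  have "W * ?D (\<lambda>x. x) = ?V * (U * ?D (\<lambda>x. x) * ?U) * U"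
    unfolding W_def by (simp add: assoc mc c u(1) right_mult_one_mat[OF mat_diag_dim])
  also have "\<dots> = ?V * (V * ?E (\<lambda>x. x) * ?V) * U" using eq by simp
  also have "\<dots> = (?V * V) * (?E (\<lambda>x. x) * W)"
    unfolding W_def by (simp add: assoc mc c del: u)
  also have "\<dots> = ?E (\<lambda>x. x) * W"
    using c W by (simp add: u mc left_mult_one_mat[OF mc])
  finally have WD: "W * ?D (\<lambda>x. x) = ?E (\<lambda>x. x) * W" .
  have entry: "W $$ (i, j) * d j = e i * W $$ (i, j)" if "i < N" "j < N" for i j
    using arg_cong[OF WD, of "\<lambda>M. M $$ (i, j)"] that W
    by (simp add: mat_diag_mult_left[OF W] mat_diag_mult_right[OF W])
  have WF: "W * ?D f = ?E f * W"
  proof (rule eq_matI)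
    fix i j assume "i < dim_row (?E f * W)" "j < dim_col (?E f * W)"
    then have ij: "i < N" "j < N" using W by (auto simp: mat_diag_def)
    have "W $$ (i, j) = 0 \<or> d j = e i" using entry[OF ij] by auto
    then show "(W * ?D f) $$ (i, j) = (?E f * W) $$ (i, j)"
      using ij by (auto simp: mat_diag_mult_left[OF W] mat_diag_mult_right[OF W])
  qed (use W in \<open>auto simp: mat_diag_def\<close>)
  have "U * ?D f * ?U = V * (?V * (U * ?D f * ?U))"
    using c by (simp add: assoc[symmetric] mc u left_mult_one_mat[OF mc] del: assoc)
  also have "\<dots> = V * (W * ?D f) * ?U" unfolding W_def by (simp add: assoc mc c)
  also have "\<dots> = V * (?E f * W) * ?U" by (simp add: WF)
  also have "\<dots> = V * ?E f * ?V"
    unfolding W_def by (simp add: assoc mc c u right_mult_one_mat[OF c(4)])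
  finally show ?thesis .
qed

lemma hermitian_fun_eq:
  assumes "unitary_on N U"
    and "A = U * mat_diag N (\<lambda>i. complex_of_real (d i)) * mat_adjoint U"
  shows "hermitian_fun f A = U * mat_diag N (\<lambda>i. complex_of_real (f (d i))) * mat_adjoint U"
proof -
  have N: "dim_row A = N" using assms by (auto simp: unitary_on_def)
  show ?thesis unfolding hermitian_fun_def N
    by (rule some_equality) (use assms hermitian_fun_unique in blast)+
qed

text \<open>The convention \<open>0 log 0 = 0\<close> is respected, since \<^term>\<open>log 2 0\<close> has the
  finite value \<open>0\<close>.\<close>

definition von_neumann_entropy :: "complex mat \<Rightarrow> real" where
  "von_neumann_entropy \<rho> = - Re (mat_trace (\<rho> * hermitian_fun (log 2) \<rho>))"

definition algorithm_unitary ::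
  "nat \<Rightarrow> nat \<Rightarrow> complex mat \<Rightarrow> complex mat \<Rightarrow> complex mat \<Rightarrow> complex mat" where
  "algorithm_unitary n m V W U = W * kronecker U (1\<^sub>m (2 ^ (n - m))) * V"

definition final_state ::
  "nat \<Rightarrow> nat \<Rightarrow> complex mat \<Rightarrow> complex mat \<Rightarrow> complex Matrix.vec \<Rightarrow> complex mat \<Rightarrow> complex mat" where
  "final_state n m V W \<psi> U =
     algorithm_unitary n m V W U * projector \<psi> * mat_adjoint (algorithm_unitary n m V W U)"

definition averaged_state ::
  "nat \<Rightarrow> nat \<Rightarrow> complex mat \<Rightarrow> complex mat \<Rightarrow> complex Matrix.vec \<Rightarrow>
   'f set \<Rightarrow> ('f \<Rightarrow> complex mat) \<Rightarrow> ('f \<Rightarrow> real) \<Rightarrow> complex mat" where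
  "averaged_state n m V W \<psi> \<F> U p =
     Matrix.mat (2 ^ n) (2 ^ n)
       (\<lambda>ij. \<Sum>f\<in>\<F>. complex_of_real (p f) * final_state n m V W \<psi> (U f) $$ ij)"

definition rho_Y ::
  "nat \<Rightarrow> nat \<Rightarrow> nat \<Rightarrow> complex mat \<Rightarrow> complex mat \<Rightarrow> complex Matrix.vec \<Rightarrow>
   'f set \<Rightarrow> ('f \<Rightarrow> complex mat) \<Rightarrow> ('f \<Rightarrow> real) \<Rightarrow> complex mat" where
  "rho_Y n k m V W \<psi> \<F> U p =
     partial_trace (2 ^ k) (2 ^ (n - k)) (averaged_state n m V W \<psi> \<F> U p)"

text \<open>\<open>Pr(Y = y | F = f)\<close>; the diagonal entry is a nonnegative real.\<close>

definition outcome_prob ::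
  "nat \<Rightarrow> nat \<Rightarrow> nat \<Rightarrow> complex mat \<Rightarrow> complex mat \<Rightarrow> complex Matrix.vec \<Rightarrow>
   complex mat \<Rightarrow> nat \<Rightarrow> real" where
  "outcome_prob n k m V W \<psi> U y =
     Re (partial_trace (2 ^ k) (2 ^ (n - k)) (final_state n m V W \<psi> U) $$ (y, y))"

text \<open>The joint law of \<open>(F, Y)\<close>. On this space \<open>F\<close> is \<^const>\<open>fst\<close> and \<open>Y\<close> is \<^const>\<open>snd\<close>.\<close>

definition joint_law ::
  "nat \<Rightarrow> nat \<Rightarrow> nat \<Rightarrow> complex mat \<Rightarrow> complex mat \<Rightarrow> complex Matrix.vec \<Rightarrow>
   'f set \<Rightarrow> ('f \<Rightarrow> complex mat) \<Rightarrow> ('f \<Rightarrow> real) \<Rightarrow> ('f \<times> nat) measure" where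
  "joint_law n k m V W \<psi> \<F> U p =
     point_measure (\<F> \<times> {..<2 ^ k})
       (\<lambda>(f, y). ennreal (p f * outcome_prob n k m V W \<psi> (U f) y))"

definition class_index :: "'j set \<Rightarrow> ('j \<Rightarrow> 'f set) \<Rightarrow> 'f \<Rightarrow> 'j" where
  "class_index \<J> A f = (THE j. j \<in> \<J> \<and> f \<in> A j)"

end

theory Submission
  imports Defs
begin

text \<open>
  Diagonalise \<open>\<rho>\<^sub>Y = U diag(d) U\<^sup>\<dagger>\<close>. The outcome probabilities, which are the diagonal of \<open>\<rho>\<^sub>Y\<close>, are
  \<open>q\<^sub>y = (\<Sum>\<^sub>i |U\<^sub>y\<^sub>i|\<^sup>2 d\<^sub>i)\<close>, the image of the spectrum under a doubly stochastic matrix, and such a mixing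
  does not decrease Shannon entropy. Hence \<open>H(Y) \<ge> S(\<rho>\<^sub>Y)\<close>, and subtracting \<open>H(Y | J)\<close> gives the
  bound on \<open>I(J; Y)\<close>.
\<close>

(* Frees the dollar sign for the entries of Jordan_Normal_Form vectors. *)
unbundle no vec_syntax

subsection \<open>Unitary diagonalisation of Hermitian matrices\<close>

lemma mat_adjoint_dim [simp]:
  "dim_row (mat_adjoint A) = dim_col A" "dim_col (mat_adjoint A) = dim_row A"
  by (auto simp: mat_adjoint_def)

lemma mat_adjoint_index [simp]:
  fixes A :: "complex mat"
  shows "i < dim_col A \<Longrightarrow> j < dim_row A \<Longrightarrow> mat_adjoint A $$ (i, j) = cnj (A $$ (j, i))"
  by (simp add: mat_adjoint_def mat_of_rows_index)

text \<open>Turns entries of products into plain finite sums. Later proofs delete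
  \<open>index_mult_mat(1)\<close> so that the simplifier uses this form rather than scalar products
  of rows and columns.\<close>

lemma mat_mult_index_sum:
  "i < dim_row A \<Longrightarrow> j < dim_col B \<Longrightarrow>
    (A * B) $$ (i, j) = (\<Sum>k<dim_row B. A $$ (i, k) * B $$ (k, j))"
  if "dim_col A = dim_row B"
  using that by (simp add: scalar_prod_def atLeast0LessThan)

lemma mat_adjoint_mult:
  fixes A B :: "complex mat"
  assumes "dim_col A = dim_row B"
  shows "mat_adjoint (A * B) = mat_adjoint B * mat_adjoint A"
  using assms by (intro eq_matI) (auto simp: mat_mult_index_sum mult.commute simp del: index_mult_mat(1))

lemma mat_adjoint_mat_adjoint [simp]: "mat_adjoint (mat_adjoint A) = (A :: complex mat)"
  by (intro eq_matI) auto

text \<open>For square matrices a left inverse is also a right inverse, so one of the two equations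
  in \<open>unitary_on\<close> suffices.\<close>

lemma unitary_onI:
  assumes "U \<in> carrier_mat N N" "mat_adjoint U * U = 1\<^sub>m N"
  shows "unitary_on N U"
  using assms mat_mult_left_right_inverse[OF mat_adjoint_carrier[OF assms(1)] assms(1)]
  by (simp add: unitary_on_def)

lemma unitary_on_mult:
  assumes "unitary_on N U" "unitary_on N V"
  shows "unitary_on N (U * V)"
proof (rule unitary_onI)
  have c: "U \<in> carrier_mat N N" "V \<in> carrier_mat N N"
    and u: "mat_adjoint U * U = 1\<^sub>m N" "mat_adjoint V * V = 1\<^sub>m N"
    using assms by (auto simp: unitary_on_def)
  show "U * V \<in> carrier_mat N N" using c by auto
  have "mat_adjoint (U * V) * (U * V) = mat_adjoint V * (mat_adjoint U * U) * V"
    using c by (simp add: mat_adjoint_mult mat_adjoint_carrier assoc_mult_mat[of _ N N _ N _ N]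
        mult_carrier_mat[of _ N N _ N])
  also have "\<dots> = 1\<^sub>m N"
    using c by (simp add: u right_mult_one_mat[OF mat_adjoint_carrier])
  finally show "mat_adjoint (U * V) * (U * V) = 1\<^sub>m N" .
qed

text \<open>Complete \<open>v\<close> to a basis and orthogonalise it by Gram-Schmidt, which leaves
  the first vector unchanged; the normalised results are the columns of \<open>W\<close>.\<close>

lemma unitary_extends_vec:
  fixes v :: "complex Matrix.vec"
  assumes v: "v \<in> carrier_vec n" and v0: "v \<noteq> 0\<^sub>v n" and n: "n \<noteq> 0"
  obtains W c where "unitary_on n W" "col W 0 = c \<cdot>\<^sub>v v"
proof -
  interpret cof_vec_space n "TYPE(complex)" .
  define b where "b = basis_completion v"
  define ws where "ws = gram_schmidt n b"
  note bc = basis_completion[OF v v0, folded b_def]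
  from bc(6,7) n obtain vs where bv: "b = v # vs" by (cases b) auto
  from gram_schmidt_result[OF bc(2,4,5) refl, folded ws_def]
  have ws: "set ws \<subseteq> carrier_vec n" "corthogonal ws" "length ws = n"
    by (auto simp: bc(6))
  have hd: "hd ws = v" using gram_schmidt_hd[OF v, of vs, folded bv] by (simp add: ws_def)
  \<comment> \<open>\<open>corthogonal\<close> provides orthogonal nonzero vectors, not unit
    vectors; \<open>c i\<close> is the reciprocal of the norm of \<open>ws ! i\<close>.\<close>
  define c where "c = (\<lambda>i. complex_of_real (1 / sqrt (Re ((ws ! i) \<bullet>c (ws ! i)))))"
  define W where "W = Matrix.mat n n (\<lambda>(i, j). c j * ws ! j $ i)"
  have W: "W \<in> carrier_mat n n" by (simp add: W_def)
  have dim: "ws ! i \<in> carrier_vec n" if "i < n" for i using ws that by auto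
  have "mat_adjoint W * W = 1\<^sub>m n"
  proof (rule eq_matI)
    fix i j assume "i < dim_row (1\<^sub>m n :: complex mat)" "j < dim_col (1\<^sub>m n :: complex mat)"
    then have ij: "i < n" "j < n" by auto
    let ?p = "(ws ! j) \<bullet>c (ws ! i)"
    have "(mat_adjoint W * W) $$ (i, j) = (\<Sum>k<n. cnj (c i) * c j * (ws ! j $ k * cnj (ws ! i $ k)))"
      using ij W by (simp add: mat_mult_index_sum W_def mult_ac del: index_mult_mat(1))
    also have "\<dots> = cnj (c i) * c j * ?p"
      using ij dim[of i] dim[of j]
      by (simp add: scalar_prod_def atLeast0LessThan sum_distrib_left)
    also have "\<dots> = 1\<^sub>m n $$ (i, j)"
    proof (cases "i = j")
      case True
      \<comment> \<open>In the order on complex numbers, \<open>?p \<ge> 0\<close> also says that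
        \<open>?p\<close> is real, so it equals its real part and cancels against the squared
        normalising factor.\<close>
      have "?p \<ge> 0" using True by (simp add: conjugate_square_ge_0_vec)
      moreover have "?p \<noteq> 0"
        using corthogonalD[OF ws(2), of j i] ws(3) ij True by simp
      ultimately have p: "?p = complex_of_real (Re ?p)" "Re ?p > 0"
        by (auto simp: complex_eq_iff less_eq_complex_def order_less_le)
      have "cnj (c i) * c j = complex_of_real (1 / Re ?p)"
        using p(2) True by (simp add: c_def flip: of_real_mult)
      then have "cnj (c i) * c j * ?p = complex_of_real (1 / Re ?p * Re ?p)"
        using p(1) by (metis of_real_mult)
      then show ?thesis using p(2) True ij by simp
    next
      case False
      then have "?p = 0" using corthogonalD[OF ws(2), of j i] ws(3) ij by simp
      then show ?thesis using False ij by simp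
    qed
    finally show "(mat_adjoint W * W) $$ (i, j) = 1\<^sub>m n $$ (i, j)" .
  qed (use W in auto)
  then have "unitary_on n W" using W by (rule unitary_onI[rotated])
  moreover have "ws ! 0 = v" using hd ws(3) n by (metis hd_conv_nth list.size(3))
  then have "col W 0 = c 0 \<cdot>\<^sub>v v"
    using n v by (intro eq_vecI) (auto simp: W_def)
  ultimately show ?thesis by (rule that)
qed

text \<open>The characteristic polynomial splits over the complex numbers and has positive degree,
  so there is an eigenvector. Take \<open>W\<close> with a multiple of it as column 0: entry
  \<open>(i, 0)\<close> is then \<open>e\<close> times the inner product of columns \<open>i\<close>
  and 0 of \<open>W\<close>.\<close>

lemma hermitian_deflation:
  fixes A :: "complex mat"
  assumes A: "A \<in> carrier_mat (Suc n) (Suc n)" and herm: "mat_adjoint A = A"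
  obtains W e where "unitary_on (Suc n) W"
    "\<And>i. i < Suc n \<Longrightarrow> (mat_adjoint W * A * W) $$ (i, 0) = (if i = 0 then e else 0)"
proof -
  obtain es where cp: "char_poly A = (\<Prod>a\<leftarrow>es. [:- a, 1:])" and len: "length es = Suc n"
    using char_poly_factorized[OF A] by auto
  then obtain e where "e \<in> set es" by (cases es) auto
  then have "poly (char_poly A) e = 0"
    unfolding cp poly_prod_list by auto
  then have "eigenvalue A e" by (simp add: eigenvalue_root_char_poly[OF A])
  then obtain v where v: "v \<in> carrier_vec (Suc n)" "v \<noteq> 0\<^sub>v (Suc n)" "A *\<^sub>v v = e \<cdot>\<^sub>v v"
    using A by (auto simp: eigenvalue_def eigenvector_def)
  obtain W c where W: "unitary_on (Suc n) W" and c: "col W 0 = c \<cdot>\<^sub>v v"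
    using unitary_extends_vec[OF v(1,2)] by blast
  note w = W[unfolded unitary_on_def]
  have "A *\<^sub>v col W 0 = e \<cdot>\<^sub>v col W 0"
    using v A by (simp add: c mult_mat_vec smult_smult_assoc mult.commute)
  have "(mat_adjoint W * A * W) $$ (i, 0) = (if i = 0 then e else 0)" if i: "i < Suc n" for i
  proof -
    have "(mat_adjoint W * A * W) $$ (i, 0) = row (mat_adjoint W) i \<bullet> (A *\<^sub>v col W 0)"
      using w A i
      by (subst assoc_mult_mat[of _ "Suc n" "Suc n" _ "Suc n" _ "Suc n"], 
          auto simp: mat_adjoint_carrier mult_mat_vec_def)
    also have "\<dots> = e * (row (mat_adjoint W) i \<bullet> col W 0)"
      using w i by (subst \<open>A *\<^sub>v col W 0 = _\<close>, intro scalar_prod_smult_distrib[of _ "Suc n"]) 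
        (auto simp: mat_adjoint_carrier intro!: carrier_vecI)
    also have "row (mat_adjoint W) i \<bullet> col W 0 = (mat_adjoint W * W) $$ (i, 0)"
      using w i by (subst index_mult_mat(1)) auto
    finally show ?thesis using w i by simp
  qed
  with W show ?thesis by (rule that)
qed

lemma unitary_conj_cancel:
  assumes "unitary_on N W" "A \<in> carrier_mat N N"
  shows "W * (mat_adjoint W * A * W) * mat_adjoint W = A"
proof -
  have w: "W \<in> carrier_mat N N" "W * mat_adjoint W = 1\<^sub>m N"
    using assms by (auto simp: unitary_on_def)
  have "W * (mat_adjoint W * A * W) * mat_adjoint W = (W * mat_adjoint W) * A * (W * mat_adjoint W)"
    using w(1) assms(2)
    by (simp add: mat_adjoint_carrier assoc_mult_mat[of _ N N _ N _ N] mult_carrier_mat[of _ N N _ N])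
  then show ?thesis using w assms(2) by simp
qed

lemma mult_block_diag:
  fixes P Q P' Q' :: "'a :: semiring_1 mat"
  assumes "P \<in> carrier_mat a a" "P' \<in> carrier_mat a a" "Q \<in> carrier_mat b b" "Q' \<in> carrier_mat b b"
  shows "four_block_mat P (0\<^sub>m a b) (0\<^sub>m b a) Q * four_block_mat P' (0\<^sub>m a b) (0\<^sub>m b a) Q' =
    four_block_mat (P * P') (0\<^sub>m a b) (0\<^sub>m b a) (Q * Q')"
  using assms by (subst mult_four_block_mat[of _ a a _ b _ b _ _ a _ b]) (auto intro!: arg_cong2[of _ _ _ _ "\<lambda>X Y. four_block_mat X _ _ Y"])

text \<open>Induction on the dimension. After deflation, Hermitian symmetry clears the first row as
  well as the first column, leaving \<open>e\<close> and a Hermitian block \<open>C\<close> of size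
  \<open>n\<close>. The unitary \<open>Q\<close> for this block is extended by a 1 in the corner and
  composed with \<open>W\<close>.\<close>

theorem hermitian_diagonalization:
  fixes A :: "complex mat"
  assumes "A \<in> carrier_mat n n" "mat_adjoint A = A"
  shows "\<exists>U d. unitary_on n U \<and>
    A = U * mat_diag n (\<lambda>i. complex_of_real (d i)) * mat_adjoint U"
  using assms
proof (induction n arbitrary: A)
  case 0
  have "unitary_on 0 (1\<^sub>m 0)" by (rule unitary_onI) auto
  moreover have "A = 1\<^sub>m 0 * mat_diag 0 (\<lambda>i. complex_of_real ((\<lambda>_. 0) i)) * mat_adjoint (1\<^sub>m 0)"
    using 0 by (intro eq_matI) auto
  ultimately show ?case by (intro exI conjI)
next
  case (Suc n)
  obtain W e where W: "unitary_on (Suc n) W"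
    and col0: "\<And>i. i < Suc n \<Longrightarrow> (mat_adjoint W * A * W) $$ (i, 0) = (if i = 0 then e else 0)"
    using hermitian_deflation[OF Suc.prems] by blast
  note w = W[unfolded unitary_on_def]
  define B where "B = mat_adjoint W * A * W"
  have B: "B \<in> carrier_mat (Suc n) (Suc n)"
    using w Suc.prems by (auto simp: B_def mat_adjoint_carrier)
  have hB: "mat_adjoint B = B"
    using w Suc.prems carrier_matD[OF Suc.prems(1)] carrier_matD[of W "Suc n" "Suc n"]
    by (simp add: B_def mat_adjoint_mult mat_adjoint_carrier
        assoc_mult_mat[of _ "Suc n" "Suc n" _ "Suc n" _ "Suc n"])
  have sym: "cnj (B $$ (j, i)) = B $$ (i, j)" if "i < Suc n" "j < Suc n" for i j
    using mat_adjoint_index[of i B j] that B hB by simp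
  \<comment> \<open>\<open>e\<close> is a diagonal entry of a Hermitian matrix, hence its own
    conjugate.\<close>
  have e: "e = complex_of_real (Re e)"
    using sym[of 0 0] col0[of 0] by (auto simp: B_def complex_eq_iff)
  define C where "C = Matrix.mat n n (\<lambda>(i, j). B $$ (Suc i, Suc j))"
  have "mat_adjoint C = C" by (rule eq_matI) (auto simp: C_def sym)
  then obtain Q d where Q: "unitary_on n Q"
    and C: "C = Q * mat_diag n (\<lambda>i. complex_of_real (d i)) * mat_adjoint Q"
    using Suc.IH[of C] by (auto simp: C_def)
  note q = Q[unfolded unitary_on_def]
  let ?Z = "0\<^sub>m 1 n" and ?Z' = "0\<^sub>m n 1"
  define R where "R = four_block_mat (1\<^sub>m 1) ?Z ?Z' Q"
  define d' where "d' = case_nat (Re e) d"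
  have adjR: "mat_adjoint R = four_block_mat (1\<^sub>m 1) ?Z ?Z' (mat_adjoint Q)"
    using q by (intro eq_matI) (auto simp: R_def)
  have R: "R \<in> carrier_mat (Suc n) (Suc n)" using q by (auto simp: R_def)
  have "mat_adjoint R * R = four_block_mat (1\<^sub>m 1) ?Z ?Z' (1\<^sub>m n)"
    unfolding adjR unfolding R_def using q
    by (subst mult_block_diag[where a = 1 and b = n]) (auto simp: mat_adjoint_carrier)
  then have "unitary_on (Suc n) R"
    using R by (intro unitary_onI) auto
  have diag: "mat_diag (Suc n) (\<lambda>i. complex_of_real (d' i)) =
      four_block_mat (mat_diag 1 (\<lambda>_. e)) ?Z ?Z' (mat_diag n (\<lambda>i. complex_of_real (d i)))"
    using e by (intro eq_matI) (auto simp: mat_diag_def d'_def split: nat.splits)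
  have "R * mat_diag (Suc n) (\<lambda>i. complex_of_real (d' i)) * mat_adjoint R =
      four_block_mat (mat_diag 1 (\<lambda>_. e)) ?Z ?Z' C"
    unfolding adjR diag unfolding R_def using q
    by (simp add: mult_block_diag[where a = "Suc 0" and b = n] mat_adjoint_carrier
        mult_carrier_mat[of _ n n _ n] left_mult_one_mat[OF mat_diag_dim]
        right_mult_one_mat[OF mat_diag_dim] C)
  also have "\<dots> = B"
  proof (rule eq_matI)
    fix i j assume "i < dim_row B" "j < dim_col B"
    then have ij: "i < Suc n" "j < Suc n" using B by auto
    \<comment> \<open>Row 0 is the conjugate of column 0, and \<open>e\<close> is real.\<close>
    have "B $$ (0, j) = (if j = 0 then e else 0)"
      using sym[of 0 j] ij col0[of j] e by (auto simp: B_def complex_eq_iff)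
    then show "four_block_mat (mat_diag 1 (\<lambda>_. e)) ?Z ?Z' C $$ (i, j) = B $$ (i, j)"
      using ij col0[of i, folded B_def] by (auto simp: mat_diag_def C_def)
  qed (use B in \<open>auto simp: C_def mat_diag_def\<close>)
  finally have "A = W * (R * mat_diag (Suc n) (\<lambda>i. complex_of_real (d' i)) * mat_adjoint R) * mat_adjoint W"
    using unitary_conj_cancel[OF W Suc.prems(1)] by (simp add: B_def)
  also have "\<dots> = (W * R) * mat_diag (Suc n) (\<lambda>i. complex_of_real (d' i)) * mat_adjoint (W * R)"
    using w R carrier_matD[of W "Suc n" "Suc n"] carrier_matD[OF R]
    by (simp add: mat_adjoint_mult mat_adjoint_carrier
        assoc_mult_mat[of _ "Suc n" "Suc n" _ "Suc n" _ "Suc n"] mult_carrier_mat[of _ "Suc n" "Suc n" _ "Suc n"])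
  finally show ?case
    using unitary_on_mult[OF W \<open>unitary_on (Suc n) R\<close>] by blast
qed

subsection \<open>Entropy of the diagonal\<close>

text \<open>A form of Gibbs' inequality: apply \<open>ln x \<le> x - 1\<close> at
  \<open>x = q i / d j\<close>, weight by \<open>B i j * d j\<close> and sum. The linear terms
  cancel because \<open>B\<close> is doubly stochastic.\<close>

lemma mixing_entropy:
  fixes B :: "'a \<Rightarrow> 'b \<Rightarrow> real" and d :: "'b \<Rightarrow> real"
  assumes B: "\<And>i j. i \<in> I \<Longrightarrow> j \<in> K \<Longrightarrow> 0 \<le> B i j"
    and row: "\<And>i. i \<in> I \<Longrightarrow> (\<Sum>j\<in>K. B i j) = 1"
    and col: "\<And>j. j \<in> K \<Longrightarrow> (\<Sum>i\<in>I. B i j) = 1"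
    and d: "\<And>j. j \<in> K \<Longrightarrow> 0 \<le> d j" and K: "finite K"
  defines "q \<equiv> \<lambda>i. \<Sum>j\<in>K. B i j * d j"
  shows "(\<Sum>i\<in>I. q i * log 2 (q i)) \<le> (\<Sum>j\<in>K. d j * log 2 (d j))"
proof -
  have pointwise: "B i j * d j * (log 2 (q i) - log 2 (d j)) \<le> B i j * (q i - d j) / ln 2"
    if ij: "i \<in> I" "j \<in> K" for i j
  proof (cases "B i j * d j = 0")
    \<comment> \<open>If \<open>B i j = 0\<close>, both sides vanish. If \<open>d j = 0\<close>, the
      left side vanishes and the right side is \<open>B i j * q i / ln 2\<close>, which is
      nonnegative.\<close>
    case True
    have "0 \<le> q i" using B d ij by (auto simp: q_def intro!: sum_nonneg)
    with True B[OF ij] d[OF ij(2)] show ?thesis by auto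
  next
    case False
    then have pos: "0 < B i j" "0 < d j" using B[OF ij] d[OF ij(2)] by auto
    \<comment> \<open>The positive number \<open>B i j * d j\<close> is one of the nonnegative
      summands of \<open>q i\<close>; this makes the logarithm of \<open>q i\<close> a genuine
      one.\<close>
    have "B i j * d j \<le> q i"
      unfolding q_def using B d ij K by (intro member_le_sum) auto
    then have q: "0 < q i" using pos by (smt (verit) mult_pos_pos)
    have "ln (q i / d j) \<le> q i / d j - 1"
      using q pos by (intro ln_le_minus_one) auto
    then have "d j * (ln (q i) - ln (d j)) \<le> q i - d j"
      using q pos by (simp add: ln_div field_simps)
    then have "B i j * (d j * (ln (q i) - ln (d j))) / ln 2 \<le> B i j * (q i - d j) / ln 2"
      using pos by (intro divide_right_mono mult_left_mono) auto
    then show ?thesis by (simp add: log_def diff_divide_distrib algebra_simps)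
  qed
  \<comment> \<open>Unit column sums allow the second sum to be weighted by \<open>B\<close> as
    well.\<close>
  have "(\<Sum>i\<in>I. q i * log 2 (q i)) - (\<Sum>j\<in>K. d j * log 2 (d j)) =
      (\<Sum>i\<in>I. \<Sum>j\<in>K. B i j * d j * log 2 (q i)) - (\<Sum>j\<in>K. \<Sum>i\<in>I. B i j * d j * log 2 (d j))"
    using col by (simp add: q_def flip: sum_distrib_right)
  also have "\<dots> = (\<Sum>i\<in>I. \<Sum>j\<in>K. B i j * d j * (log 2 (q i) - log 2 (d j)))"
    by (subst (2) sum.swap) (simp add: sum_subtractf right_diff_distrib)
  also have "\<dots> \<le> (\<Sum>i\<in>I. \<Sum>j\<in>K. B i j * (q i - d j) / ln 2)"
    using pointwise by (intro sum_mono)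
  also have "\<dots> = ((\<Sum>i\<in>I. \<Sum>j\<in>K. B i j * q i) - (\<Sum>i\<in>I. \<Sum>j\<in>K. B i j * d j)) / ln 2"
    by (simp add: sum_subtractf right_diff_distrib flip: sum_divide_distrib)
  \<comment> \<open>Here the row sums enter. The subtracted double sum is the sum of all
    \<open>q i\<close> by definition of \<open>q\<close>, so the upper bound is zero.\<close>
  also have "(\<Sum>i\<in>I. \<Sum>j\<in>K. B i j * q i) = (\<Sum>i\<in>I. q i)"
    using row by (simp flip: sum_distrib_right)
  finally show ?thesis by (simp add: q_def)
qed

section \<open>Spectrum, diagonal and von Neumann entropy\<close>

lemma unitary_diag_conj_index:
  assumes U: "U \<in> carrier_mat N N" and ij: "i < N" "j < N"
  shows "(U * mat_diag N g * mat_adjoint U) $$ (i, j) = (\<Sum>k<N. U $$ (i, k) * g k * cnj (U $$ (j, k)))"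
  using assms by (simp add: mat_diag_mult_right[OF U] mat_mult_index_sum del: index_mult_mat(1))

text \<open>Together with \<open>unitary_col_norm\<close> this makes the squared moduli of the
  entries of \<open>U\<close> a doubly stochastic matrix, the form in which
  \<open>mixing_entropy\<close> is applied.\<close>

lemma unitary_row_norm:
  assumes "unitary_on N U" "i < N"
  shows "(\<Sum>k<N. (cmod (U $$ (i, k)))\<^sup>2) = 1"
proof -
  have U: "U \<in> carrier_mat N N" and "U * mat_adjoint U = 1\<^sub>m N"
    using assms by (auto simp: unitary_on_def)
  have "complex_of_real (\<Sum>k<N. (cmod (U $$ (i, k)))\<^sup>2) = (U * mat_adjoint U) $$ (i, i)"
    using U assms(2) by (simp add: mat_mult_index_sum complex_norm_square del: index_mult_mat(1) of_real_power)
  also have "\<dots> = complex_of_real 1"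
    using assms by (simp add: unitary_on_def)
  finally show ?thesis by (simp only: of_real_eq_iff)
qed

lemma unitary_on_adjoint: "unitary_on N U \<Longrightarrow> unitary_on N (mat_adjoint U)"
  by (auto simp: unitary_on_def mat_adjoint_carrier)

lemma unitary_col_norm:
  assumes "unitary_on N U" "k < N"
  shows "(\<Sum>i<N. (cmod (U $$ (i, k)))\<^sup>2) = 1"
  using unitary_row_norm[OF unitary_on_adjoint[OF assms(1)] assms(2)] assms
  by (auto simp: unitary_on_def)

text \<open>The inner factor \<open>mat_adjoint U * U\<close> cancels in
  \<open>\<rho> * hermitian_fun (log 2) \<rho>\<close>, leaving the conjugate by \<open>U\<close> of
  the diagonal matrix of \<open>d i * log 2 (d i)\<close>. Swapping the sums in its trace exposes
  the squared column norms of \<open>U\<close>, which are 1.\<close>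

lemma von_neumann_entropy_spectral:
  assumes U: "unitary_on N U"
    and \<rho>: "\<rho> = U * mat_diag N (\<lambda>i. complex_of_real (d i)) * mat_adjoint U"
  shows "von_neumann_entropy \<rho> = - (\<Sum>i<N. d i * log 2 (d i))"
proof -
  let ?D = "\<lambda>g. mat_diag N (\<lambda>i. complex_of_real (g i))"
  let ?h = "\<lambda>i. d i * log 2 (d i)"
  have c: "U \<in> carrier_mat N N" and u: "mat_adjoint U * U = 1\<^sub>m N"
    using U by (auto simp: unitary_on_def)
  have h: "hermitian_fun (log 2) \<rho> = U * ?D (\<lambda>i. log 2 (d i)) * mat_adjoint U"
    by (rule hermitian_fun_eq[OF U \<rho>])
  have "\<rho> * hermitian_fun (log 2) \<rho> = U * ?D d * (mat_adjoint U * U) * ?D (\<lambda>i. log 2 (d i)) * mat_adjoint U"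
    unfolding h unfolding \<rho> using c
    by (simp add: mat_adjoint_carrier assoc_mult_mat[of _ N N _ N _ N] mult_carrier_mat[of _ N N _ N])
  also have "\<dots> = U * (?D d * ?D (\<lambda>i. log 2 (d i))) * mat_adjoint U"
    unfolding u using c
    by (simp add: mat_adjoint_carrier assoc_mult_mat[of _ N N _ N _ N] mult_carrier_mat[of _ N N _ N]
        right_mult_one_mat[OF mat_diag_dim] left_mult_one_mat[of _ N N] del: mat_diag_diag)
  also have "\<dots> = U * ?D ?h * mat_adjoint U" by simp
  finally have "mat_trace (\<rho> * hermitian_fun (log 2) \<rho>) = mat_trace (U * ?D ?h * mat_adjoint U)" by simp
  also have "\<dots> = (\<Sum>i<N. \<Sum>k<N. U $$ (i, k) * complex_of_real (?h k) * cnj (U $$ (i, k)))"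
    using c by (simp add: mat_trace_def unitary_diag_conj_index del: index_mult_mat(1))
  also have "\<dots> = (\<Sum>i<N. \<Sum>k<N. complex_of_real ((cmod (U $$ (i, k)))\<^sup>2 * ?h k))"
    by (intro sum.cong refl) (simp add: complex_norm_square mult_ac del: of_real_power)
  also have "\<dots> = (\<Sum>k<N. complex_of_real ((\<Sum>i<N. (cmod (U $$ (i, k)))\<^sup>2) * ?h k))"
    by (subst sum.swap) (simp add: sum_distrib_right)
  also have "\<dots> = complex_of_real (\<Sum>k<N. ?h k)"
    using unitary_col_norm[OF U] by simp
  finally show ?thesis by (simp add: von_neumann_entropy_def)
qed

lemma complex_norm_square_sum:
  "complex_of_real ((cmod (\<Sum>i\<in>I. a i))\<^sup>2) = (\<Sum>i\<in>I. \<Sum>j\<in>I. a i * cnj (a j))"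
  by (simp only: complex_norm_square cnj_sum sum_product)

text \<open>The hypothesis \<open>gram\<close> writes \<rho> as a nonnegative combination of the
  rank-one operators of the vectors \<open>\<phi> s\<close>. This yields both Hermiticity and
  nonnegative eigenvalues, after which the diagonal is a doubly stochastic image of the
  spectrum.\<close>

lemma von_neumann_entropy_le_diagonal:
  fixes \<phi> :: "'s \<Rightarrow> nat \<Rightarrow> complex"
  assumes \<rho>: "\<rho> \<in> carrier_mat N N" and w: "\<And>s. s \<in> S \<Longrightarrow> 0 \<le> w s"
    and gram: "\<And>i j. i < N \<Longrightarrow> j < N \<Longrightarrow>
      \<rho> $$ (i, j) = (\<Sum>s\<in>S. complex_of_real (w s) * (\<phi> s i * cnj (\<phi> s j)))"
  shows "von_neumann_entropy \<rho> \<le> - (\<Sum>i<N. Re (\<rho> $$ (i, i)) * log 2 (Re (\<rho> $$ (i, i))))"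
proof -
  have "mat_adjoint \<rho> = \<rho>"
    using \<rho> by (intro eq_matI) (auto simp: gram mult_ac)
  then obtain U d where U: "unitary_on N U"
    and eq: "\<rho> = U * mat_diag N (\<lambda>i. complex_of_real (d i)) * mat_adjoint U"
    using hermitian_diagonalization[OF \<rho>] by blast
  have c: "U \<in> carrier_mat N N" and u: "mat_adjoint U * U = 1\<^sub>m N"
    using U by (auto simp: unitary_on_def)
  \<comment> \<open>\<open>d k\<close> is the quadratic form of \<rho> at column \<open>k\<close> of
    \<open>U\<close>; by \<open>gram\<close> it is the sum over \<open>s\<close> of
    \<open>w s\<close> times the squared modulus of the inner product of that column with
    \<open>\<phi> s\<close>.\<close>
  have d: "0 \<le> d k" if k: "k < N" for k
  proof -
    have "mat_adjoint U * (\<rho> * U) = (mat_adjoint U * U) * mat_diag N (\<lambda>i. complex_of_real (d i)) * (mat_adjoint U * U)"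
      unfolding eq using c
      by (simp add: mat_adjoint_carrier assoc_mult_mat[of _ N N _ N _ N] mult_carrier_mat[of _ N N _ N])
    also have "\<dots> = mat_diag N (\<lambda>i. complex_of_real (d i))"
      by (simp add: u right_mult_one_mat[OF mat_diag_dim] left_mult_one_mat[OF mat_diag_dim])
    finally have "complex_of_real (d k) = (mat_adjoint U * (\<rho> * U)) $$ (k, k)"
      using k by (simp add: mat_diag_def)
    also have "\<dots> = (\<Sum>i<N. \<Sum>j<N. \<Sum>s\<in>S. complex_of_real (w s) * (cnj (U $$ (i, k)) * \<phi> s i * cnj (cnj (U $$ (j, k)) * \<phi> s j)))"
      using c \<rho> k
      by (simp add: mat_mult_index_sum gram sum_distrib_left sum_distrib_right mult_ac del: index_mult_mat(1))
    also have "\<dots> = (\<Sum>s\<in>S. \<Sum>i<N. \<Sum>j<N. complex_of_real (w s) * (cnj (U $$ (i, k)) * \<phi> s i * cnj (cnj (U $$ (j, k)) * \<phi> s j)))"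
      by (subst (2) sum.swap, subst (1) sum.swap) simp
    also have "\<dots> = complex_of_real (\<Sum>s\<in>S. w s * (cmod (\<Sum>i<N. cnj (U $$ (i, k)) * \<phi> s i))\<^sup>2)"
      by (simp only: of_real_sum of_real_mult complex_norm_square_sum sum_distrib_left)
    finally have "d k = (\<Sum>s\<in>S. w s * (cmod (\<Sum>i<N. cnj (U $$ (i, k)) * \<phi> s i))\<^sup>2)"
      by (simp only: of_real_eq_iff)
    then show ?thesis using w by (simp add: sum_nonneg)
  qed
  have diag: "Re (\<rho> $$ (i, i)) = (\<Sum>k<N. (cmod (U $$ (i, k)))\<^sup>2 * d k)" if "i < N" for i
  proof -
    have "\<rho> $$ (i, i) = (\<Sum>k<N. complex_of_real ((cmod (U $$ (i, k)))\<^sup>2 * d k))"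
      unfolding eq using c that
      by (simp add: unitary_diag_conj_index complex_norm_square mult_ac
          del: index_mult_mat(1) of_real_power)
    then show ?thesis by simp
  qed
  have "(\<Sum>i<N. Re (\<rho> $$ (i, i)) * log 2 (Re (\<rho> $$ (i, i)))) \<le> (\<Sum>k<N. d k * log 2 (d k))"
    using mixing_entropy[of "{..<N}" "{..<N}" "\<lambda>i k. (cmod (U $$ (i, k)))\<^sup>2" d] d
      unitary_row_norm[OF U] unitary_col_norm[OF U]
    by (simp add: diag)
  then show ?thesis by (simp add: von_neumann_entropy_spectral[OF U eq])
qed

section \<open>Tensor products, norm preservation and pure final states\<close>

text \<open>The index \<open>i * b + l\<close> has the first tensor factor as its leading part, the
  convention of \<open>kronecker\<close> and \<open>partial_trace\<close>.\<close>

lemma sum_grid: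
  fixes f :: "nat \<Rightarrow> 'a :: comm_monoid_add"
  shows "(\<Sum>r<a * b. f r) = (\<Sum>i<a. \<Sum>l<b. f (i * b + l))"
proof -
  have "(\<Sum>l<b. f (i * b + l)) = sum f {i * b..<i * b + b}" for i
    using sum.shift_bounds_nat_ivl[of f 0 "i * b" b]
    by (simp add: atLeast0LessThan add.commute)
  then show ?thesis by (simp add: sum.nat_group)
qed

lemma grid_less: "i < a \<Longrightarrow> l < b \<Longrightarrow> i * b + l < a * (b :: nat)"
  by (metis (no_types, lifting) add.commute add_less_cancel_left less_le_trans mult_Suc mult_le_mono1 Suc_leI)

lemma kronecker_carrier:
  "A \<in> carrier_mat a a \<Longrightarrow> B \<in> carrier_mat b b \<Longrightarrow> kronecker A B \<in> carrier_mat (a * b) (a * b)"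
  by (auto simp: kronecker_def)

text \<open>Splitting the summation index by \<open>sum_grid\<close> factors each entry of the
  product into an entry of \<open>mat_adjoint A * A\<close> and one of
  \<open>mat_adjoint B * B\<close>.\<close>

lemma unitary_on_kronecker:
  assumes A: "unitary_on a A" and B: "unitary_on b B"
  shows "unitary_on (a * b) (kronecker A B)"
proof (rule unitary_onI)
  have c: "A \<in> carrier_mat a a" "B \<in> carrier_mat b b"
    and u: "mat_adjoint A * A = 1\<^sub>m a" "mat_adjoint B * B = 1\<^sub>m b"
    using assms by (auto simp: unitary_on_def)
  show K: "kronecker A B \<in> carrier_mat (a * b) (a * b)" using c by (rule kronecker_carrier)
  show "mat_adjoint (kronecker A B) * kronecker A B = 1\<^sub>m (a * b)"
  proof (rule eq_matI)
    fix i j assume "i < dim_row (1\<^sub>m (a * b) :: complex mat)" "j < dim_col (1\<^sub>m (a * b) :: complex mat)"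
    then have ij: "i < a * b" "j < a * b" by auto
    then have b: "0 < b" by (auto intro: gr0I)
    have lt: "i div b < a" "j div b < a" "i mod b < b" "j mod b < b"
      using ij b by (auto simp: less_mult_imp_div_less)
    have idx: "kronecker A B $$ (x * b + y, l) = A $$ (x, l div b) * B $$ (y, l mod b)"
      if "x < a" "y < b" "l < a * b" for x y l
      using that c grid_less[of x a y b] by (simp add: kronecker_def)
    have "(mat_adjoint (kronecker A B) * kronecker A B) $$ (i, j) =
        (\<Sum>x<a. \<Sum>y<b. cnj (kronecker A B $$ (x * b + y, i)) * kronecker A B $$ (x * b + y, j))"
      using K ij by (simp add: mat_mult_index_sum sum_grid grid_less del: index_mult_mat(1))
    also have "\<dots> = (\<Sum>x<a. cnj (A $$ (x, i div b)) * A $$ (x, j div b)) *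
        (\<Sum>y<b. cnj (B $$ (y, i mod b)) * B $$ (y, j mod b))"
      using ij by (simp add: idx sum_product mult_ac)
    also have "\<dots> = (mat_adjoint A * A) $$ (i div b, j div b) * (mat_adjoint B * B) $$ (i mod b, j mod b)"
      using c lt by (simp add: mat_mult_index_sum del: index_mult_mat(1))
    \<comment> \<open>Quotient and remainder modulo \<open>b\<close> determine the index, so two
      Kronecker deltas combine into one.\<close>
    also have "\<dots> = 1\<^sub>m (a * b) $$ (i, j)"
      using lt ij by (auto simp: u) (metis div_mult_mod_eq)
    finally show "(mat_adjoint (kronecker A B) * kronecker A B) $$ (i, j) = 1\<^sub>m (a * b) $$ (i, j)" .
  qed (use K in auto)
qed

lemma unitary_on_one: "unitary_on N (1\<^sub>m N)"
proof -
  have "mat_adjoint (1\<^sub>m N) = (1\<^sub>m N :: complex mat)" by (intro eq_matI) auto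
  then show ?thesis by (simp add: unitary_on_def)
qed

lemma unitary_on_algorithm_unitary:
  assumes "m \<le> n" "unitary_on (2 ^ n) V" "unitary_on (2 ^ n) W" "unitary_on (2 ^ m) U"
  shows "unitary_on (2 ^ n) (algorithm_unitary n m V W U)"
proof -
  have "unitary_on (2 ^ n) (kronecker U (1\<^sub>m (2 ^ (n - m))))"
    using unitary_on_kronecker[OF assms(4) unitary_on_one, of "2 ^ (n - m)"] assms(1)
    by (simp flip: power_add)
  then show ?thesis
    unfolding algorithm_unitary_def using assms(2,3) by (intro unitary_on_mult)
qed

text \<open>Expanding the squares and moving the sum over \<open>i\<close> innermost produces the
  entries of \<open>mat_adjoint U * U\<close>, which is the identity.\<close>

lemma unitary_mult_vec_norm:
  assumes U: "unitary_on N U" and \<psi>: "\<psi> \<in> carrier_vec N"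
  shows "(\<Sum>i<N. (cmod ((U *\<^sub>v \<psi>) $ i))\<^sup>2) = (\<Sum>i<N. (cmod (\<psi> $ i))\<^sup>2)"
proof -
  have c: "U \<in> carrier_mat N N" and u: "mat_adjoint U * U = 1\<^sub>m N"
    using U by (auto simp: unitary_on_def)
  have entry: "(U *\<^sub>v \<psi>) $ i = (\<Sum>k<N. U $$ (i, k) * \<psi> $ k)" if "i < N" for i
    using c \<psi> that by (auto simp: scalar_prod_def atLeast0LessThan)
  have "complex_of_real (\<Sum>i<N. (cmod ((U *\<^sub>v \<psi>) $ i))\<^sup>2) =
      (\<Sum>i<N. \<Sum>j<N. \<Sum>k<N. (U $$ (i, j) * \<psi> $ j) * cnj (U $$ (i, k) * \<psi> $ k))"
    unfolding of_real_sum
    by (intro sum.cong refl) (simp only: entry lessThan_iff complex_norm_square_sum)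
  also have "\<dots> = (\<Sum>j<N. \<Sum>k<N. \<Sum>i<N. (U $$ (i, j) * \<psi> $ j) * cnj (U $$ (i, k) * \<psi> $ k))"
    by (rule trans[OF sum.swap], rule sum.cong[OF refl], rule sum.swap)
  also have "\<dots> = (\<Sum>j<N. \<Sum>k<N. \<psi> $ j * cnj (\<psi> $ k) * (mat_adjoint U * U) $$ (k, j))"
    using c by (simp add: mat_mult_index_sum sum_distrib_left mult_ac del: index_mult_mat(1))
  also have "\<dots> = (\<Sum>j<N. \<Sum>k<N. if k = j then \<psi> $ j * cnj (\<psi> $ k) else 0)"
    unfolding u by (intro sum.cong refl) simp
  also have "\<dots> = (\<Sum>j<N. \<psi> $ j * cnj (\<psi> $ j))"
    by simp
  also have "\<dots> = complex_of_real (\<Sum>i<N. (cmod (\<psi> $ i))\<^sup>2)"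
    by (simp add: complex_norm_square mult_ac del: of_real_power)
  finally show ?thesis by (simp only: of_real_eq_iff)
qed

text \<open>With \<psi> as a one-column matrix, conjugating its projector by the algorithm's unitary
  gives the projector of the image vector.\<close>

lemma final_state_index:
  assumes T: "algorithm_unitary n m V W U \<in> carrier_mat (2 ^ n) (2 ^ n)"
    and \<psi>: "\<psi> \<in> carrier_vec (2 ^ n)" and ij: "i < 2 ^ n" "j < 2 ^ n"
  defines "\<phi> \<equiv> algorithm_unitary n m V W U *\<^sub>v \<psi>"
  shows "final_state n m V W \<psi> U $$ (i, j) = \<phi> $ i * cnj (\<phi> $ j)"
proof -
  let ?T = "algorithm_unitary n m V W U" and ?c = "mat_of_cols (2 ^ n) [\<psi>]"
  have c: "?c \<in> carrier_mat (2 ^ n) 1"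
    using mat_of_cols_carrier(1)[of "2 ^ n" "[\<psi>]"] by simp
  have "final_state n m V W \<psi> U = (?T * ?c) * mat_adjoint (?T * ?c)"
    using T \<psi> c carrier_matD[OF T]
    by (simp add: final_state_def projector_def mat_adjoint_mult mat_adjoint_carrier
        assoc_mult_mat[of _ "2 ^ n" "2 ^ n" _ "Suc 0" _ "2 ^ n"] assoc_mult_mat[of _ "2 ^ n" "Suc 0" _ "2 ^ n" _ "2 ^ n"]
        assoc_mult_mat[of _ "2 ^ n" "2 ^ n" _ "2 ^ n" _ "2 ^ n"]
        mult_carrier_mat[of _ "2 ^ n" "Suc 0" _ "2 ^ n"] mult_carrier_mat[of _ "2 ^ n" "2 ^ n" _ "Suc 0"] mult_carrier_mat[of _ "Suc 0" "2 ^ n" _ "2 ^ n"])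
  moreover have "(?T * ?c) $$ (i, 0) = \<phi> $ i" if "i < 2 ^ n" for i
    using that T \<psi> by (simp add: \<phi>_def)
  ultimately show ?thesis
    using ij T by (simp add: mat_mult_index_sum del: index_mult_mat(1))
qed

subsection \<open>Output distribution of the algorithm\<close>

definition final_vec ::
  "nat \<Rightarrow> nat \<Rightarrow> complex mat \<Rightarrow> complex mat \<Rightarrow> complex Matrix.vec \<Rightarrow> complex mat \<Rightarrow> complex Matrix.vec" where
  "final_vec n m V W \<psi> U = algorithm_unitary n m V W U *\<^sub>v \<psi>"

lemma grid_less_power:
  fixes i l :: nat
  assumes "k \<le> n" "i < 2 ^ k" "l < 2 ^ (n - k)"
  shows "i * 2 ^ (n - k) + l < 2 ^ n"
  using grid_less[OF assms(2,3)] assms(1) by (simp flip: power_add)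

context
  fixes n m k :: nat and V W U :: "complex mat" and \<psi> :: "complex Matrix.vec"
  assumes m: "m \<le> n" and k: "k \<le> n" and V: "unitary_on (2 ^ n) V" and W: "unitary_on (2 ^ n) W"
    and U: "unitary_on (2 ^ m) U" and \<psi>: "\<psi> \<in> carrier_vec (2 ^ n)"
begin

lemma final_state_final_vec:
  assumes "i < 2 ^ n" "j < 2 ^ n"
  shows "final_state n m V W \<psi> U $$ (i, j) = final_vec n m V W \<psi> U $ i * cnj (final_vec n m V W \<psi> U $ j)"
  using final_state_index[OF _ \<psi> assms] unitary_on_algorithm_unitary[OF m V W U]
  by (simp add: final_vec_def unitary_on_def)

text \<open>The Born rule: \<open>y\<close> gives the \<open>k\<close> leading, measured bits of a
  basis index, and \<open>l\<close> runs over the remaining \<open>n - k\<close> bits.\<close>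

lemma outcome_prob_eq:
  assumes "y < 2 ^ k"
  shows "outcome_prob n k m V W \<psi> U y =
    (\<Sum>l<2 ^ (n - k). (cmod (final_vec n m V W \<psi> U $ (y * 2 ^ (n - k) + l)))\<^sup>2)"
  using assms
  by (simp add: outcome_prob_def partial_trace_def final_state_final_vec grid_less_power[OF k]
      complex_mult_cnj cmod_power2 flip: of_real_power)

text \<open>The pairs \<open>(y, l)\<close> exhaust the basis indices, so the total is the squared
  norm of the final vector, which equals that of \<psi>.\<close>

lemma sum_outcome_prob:
  assumes "\<psi> \<bullet>c \<psi> = 1"
  shows "(\<Sum>y<2 ^ k. outcome_prob n k m V W \<psi> U y) = 1"
proof -
  have "(\<Sum>y<2 ^ k. outcome_prob n k m V W \<psi> U y) =
      (\<Sum>i<2 ^ k * 2 ^ (n - k). (cmod (final_vec n m V W \<psi> U $ i))\<^sup>2)"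
    by (simp add: outcome_prob_eq sum_grid)
  also have "\<dots> = (\<Sum>i<2 ^ n. (cmod (\<psi> $ i))\<^sup>2)"
    using k unitary_mult_vec_norm[OF unitary_on_algorithm_unitary[OF m V W U] \<psi>]
    by (simp add: final_vec_def flip: power_add)
  \<comment> \<open>The normalisation of \<psi> is an equation between complex numbers, so the real
    sum is embedded and the value pulled back.\<close>
  also have "complex_of_real \<dots> = \<psi> \<bullet>c \<psi>"
    using \<psi> unfolding of_real_sum complex_norm_square
    by (auto simp: scalar_prod_def atLeast0LessThan)
  then have "(\<Sum>i<2 ^ n. (cmod (\<psi> $ i))\<^sup>2) = 1"
    unfolding assms by (simp only: of_real_eq_1_iff)
  finally show ?thesis .
qed

end

text \<open>Ensemble form of the reduced state: one unnormalised vector per oracle \<open>f\<close>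
  and value \<open>l\<close> of the unmeasured bits, with weight \<open>p f\<close>. This is the
  shape that \<open>von_neumann_entropy_le_diagonal\<close> expects.\<close>

lemma rho_Y_index:
  assumes "m \<le> n" "k \<le> n" "unitary_on (2 ^ n) V" "unitary_on (2 ^ n) W"
    and "\<And>f. f \<in> \<F> \<Longrightarrow> unitary_on (2 ^ m) (U f)" "\<psi> \<in> carrier_vec (2 ^ n)"
    and ij: "i < 2 ^ k" "j < 2 ^ k"
  shows "rho_Y n k m V W \<psi> \<F> U p $$ (i, j) =
    (\<Sum>(f, l)\<in>\<F> \<times> {..<2 ^ (n - k)}. complex_of_real (p f) *
      (final_vec n m V W \<psi> (U f) $ (i * 2 ^ (n - k) + l) *
       cnj (final_vec n m V W \<psi> (U f) $ (j * 2 ^ (n - k) + l))))"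
proof -
  have "rho_Y n k m V W \<psi> \<F> U p $$ (i, j) =
    (\<Sum>l<2 ^ (n - k). \<Sum>f\<in>\<F>. complex_of_real (p f) *
      (final_vec n m V W \<psi> (U f) $ (i * 2 ^ (n - k) + l) *
       cnj (final_vec n m V W \<psi> (U f) $ (j * 2 ^ (n - k) + l))))"
    using assms
    by (simp add: rho_Y_def partial_trace_def averaged_state_def grid_less_power final_state_final_vec)
  then show ?thesis by (subst (asm) sum.swap) (simp add: sum.cartesian_product)
qed

text \<open>The law of total probability over the oracle; it identifies the diagonal of the reduced
  state with the law of the outcome.\<close>

lemma Re_rho_Y_diag:
  assumes "m \<le> n" "k \<le> n" "unitary_on (2 ^ n) V" "unitary_on (2 ^ n) W"
    and "\<And>f. f \<in> \<F> \<Longrightarrow> unitary_on (2 ^ m) (U f)" "\<psi> \<in> carrier_vec (2 ^ n)"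
    and y: "y < 2 ^ k"
  shows "Re (rho_Y n k m V W \<psi> \<F> U p $$ (y, y)) = (\<Sum>f\<in>\<F>. p f * outcome_prob n k m V W \<psi> (U f) y)"
proof -
  have sq: "complex_of_real c * (z * cnj z) = complex_of_real (c * (cmod z)\<^sup>2)" for c z
    by (simp add: complex_norm_square del: of_real_power)
  then show ?thesis
    using assms
    by (simp add: rho_Y_index sq outcome_prob_eq sum_distrib_left
        del: of_real_mult of_real_power flip: sum.cartesian_product)
qed

section \<open>Shannon information and finite probability spaces\<close>

text \<open>The known identity subtracts the conditional entropy of \<open>X\<close> given
  \<open>Y\<close> from the entropy of \<open>X\<close>. The chain rule in both orders and the
  symmetry of joint entropy exchange the roles.\<close>

lemma (in information_space) mutual_information_eq_entropy_conditional_entropy_swap: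
  assumes X: "simple_function M X" and Y: "simple_function M Y"
  shows "\<I>(X ; Y) = \<H>(Y) - \<H>(Y | X)"
proof -
  have Px: "simple_distributed M X (\<lambda>x. prob (X -` {x} \<inter> space M))"
    using X by (rule simple_distributedI) auto
  have Pxy: "simple_distributed M (\<lambda>x. (X x, Y x)) (\<lambda>z. prob ((\<lambda>x. (X x, Y x)) -` {z} \<inter> space M))"
    using simple_function_Pair[OF X Y] by (rule simple_distributedI) auto
  have Pyx: "simple_distributed M (\<lambda>x. (Y x, X x)) (\<lambda>z. prob ((\<lambda>x. (Y x, X x)) -` {z} \<inter> space M))"
    using simple_function_Pair[OF Y X] by (rule simple_distributedI) auto
  have "\<H>(\<lambda>x. (X x, Y x)) = \<H>(\<lambda>x. (Y x, X x))"
    unfolding entropy_simple_distributed[OF Pxy] entropy_simple_distributed[OF Pyx]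
    by (rule arg_cong[where f = uminus], rule sum.reindex_bij_witness[where i = prod.swap and j = prod.swap])
      (auto intro!: arg_cong[where f = "\<lambda>A. prob A * log b (prob A)"])
  then show ?thesis
    using mutual_information_eq_entropy_conditional_entropy[OF X Y]
      entropy_chain_rule[OF X Y] entropy_chain_rule[OF Y X] by simp
qed

lemma prob_space_point_measure:
  assumes "finite A" "\<And>a. a \<in> A \<Longrightarrow> 0 \<le> g a" "sum g A = (1 :: real)"
  shows "prob_space (point_measure A (\<lambda>a. ennreal (g a)))"
  by (rule prob_spaceI)
    (use assms in \<open>simp add: space_point_measure emeasure_point_measure_finite sum_ennreal\<close>)

lemma measure_point_measure:
  assumes "finite A" "\<And>a. a \<in> A \<Longrightarrow> 0 \<le> g a" "X \<subseteq> A"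
  shows "measure (point_measure A (\<lambda>a. ennreal (g a))) X = sum g X"
proof -
  have "emeasure (point_measure A (\<lambda>a. ennreal (g a))) X = ennreal (sum g X)"
    using assms by (simp add: emeasure_point_measure_finite subset_eq sum_ennreal)
  then show ?thesis
    using assms by (simp add: measure_def subset_eq sum_nonneg)
qed

section \<open>Entropy of the outcome and its information about the class\<close>

theorem mainTheorem4:
  fixes n m k :: nat
    and V W :: "complex mat"
    and \<psi>\<^sub>0 :: "complex Matrix.vec"
    and \<F> :: "'f set"
    and \<J> :: "'j set"
    and A :: "'j \<Rightarrow> 'f set"
    and U :: "'f \<Rightarrow> complex mat"
    and p :: "'f \<Rightarrow> real"
  defines "P \<equiv> joint_law n k m V W \<psi>\<^sub>0 \<F> U p"
    and "Y \<equiv> (snd :: 'f \<times> nat \<Rightarrow> nat)"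
    and "J \<equiv> (\<lambda>\<omega> :: 'f \<times> nat. class_index \<J> A (fst \<omega>))"
    and "\<rho>\<^sub>Y \<equiv> rho_Y n k m V W \<psi>\<^sub>0 \<F> U p"
  assumes "m \<le> n" and "k \<le> n"
    and "unitary_on (2 ^ n) V" and "unitary_on (2 ^ n) W"
    and "\<psi>\<^sub>0 \<in> carrier_vec (2 ^ n)" and "\<psi>\<^sub>0 \<bullet>c \<psi>\<^sub>0 = 1"
    and "finite \<F>"
    and "disjoint_family_on A \<J>" and "(\<Union>j\<in>\<J>. A j) = \<F>" and "\<And>j. j \<in> \<J> \<Longrightarrow> A j \<noteq> {}"
    and "\<And>f. f \<in> \<F> \<Longrightarrow> unitary_on (2 ^ m) (U f)"
    and "\<And>f. f \<in> \<F> \<Longrightarrow> 0 \<le> p f" and "(\<Sum>f\<in>\<F>. p f) = 1"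
  shows "information_space.entropy_Pow P 2 Y \<ge> von_neumann_entropy \<rho>\<^sub>Y \<and>
         information_space.mutual_information_Pow P 2 J Y
           \<ge> von_neumann_entropy \<rho>\<^sub>Y - information_space.conditional_entropy_Pow P 2 Y J"
proof -
  note alg = \<open>m \<le> n\<close> \<open>k \<le> n\<close> \<open>unitary_on (2 ^ n) V\<close> \<open>unitary_on (2 ^ n) W\<close>
  note U = \<open>\<And>f. f \<in> \<F> \<Longrightarrow> unitary_on (2 ^ m) (U f)\<close>
  note \<psi> = \<open>\<psi>\<^sub>0 \<in> carrier_vec (2 ^ n)\<close>
  let ?o = "\<lambda>f y. outcome_prob n k m V W \<psi>\<^sub>0 (U f) y"
  let ?g = "\<lambda>(f, y). p f * ?o f y"
  let ?S = "\<F> \<times> {..<2 ^ k :: nat}"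
  define q where "q y = (\<Sum>f\<in>\<F>. p f * ?o f y)" for y
  have P: "P = point_measure ?S (\<lambda>z. ennreal (?g z))"
    unfolding P_def joint_law_def by (simp add: case_prod_unfold)
  have S: "finite ?S" using \<open>finite \<F>\<close> by simp
  have o: "0 \<le> ?o f y" if "f \<in> \<F>" "y < 2 ^ k" for f y
    using outcome_prob_eq[OF alg U \<psi>, of f y] that by (simp add: sum_nonneg)
  have g: "0 \<le> ?g z" if "z \<in> ?S" for z
    using that o \<open>\<And>f. f \<in> \<F> \<Longrightarrow> 0 \<le> p f\<close> by auto
  have "sum ?g ?S = (\<Sum>f\<in>\<F>. p f * (\<Sum>y<2 ^ k. ?o f y))"
    by (simp add: sum.cartesian_product sum_distrib_left)
  also have "\<dots> = 1"
    using sum_outcome_prob[OF alg U \<psi> \<open>\<psi>\<^sub>0 \<bullet>c \<psi>\<^sub>0 = 1\<close>] \<open>(\<Sum>f\<in>\<F>. p f) = 1\<close> by simp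
  finally interpret prob_space P
    unfolding P by (intro prob_space_point_measure S g)
  interpret information_space P 2 by unfold_locales simp
  have sp: "space P = ?S" by (simp add: P space_point_measure)
  \<comment> \<open>The sample space is finite and all its subsets are measurable, so this covers
    both \<open>Y\<close> and \<open>J\<close>.\<close>
  have simple: "simple_function P X" for X :: "'f \<times> nat \<Rightarrow> 'x"
    unfolding P using S by simp
  \<comment> \<open>Nonemptiness makes the image of \<open>Y\<close> all of
    \<open>{..<2 ^ k}\<close>, including outcomes of probability zero, whose entropy terms
    vanish.\<close>
  have "\<F> \<noteq> {}" using \<open>(\<Sum>f\<in>\<F>. p f) = 1\<close> by auto
  then have Y_image: "Y ` space P = {..<2 ^ k}" by (auto simp: sp Y_def image_iff)
  have q: "q y = prob (Y -` {y} \<inter> space P)" if "y < 2 ^ k" for y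
  proof -
    have "Y -` {y} \<inter> space P = (\<lambda>f. (f, y)) ` \<F>" using that by (auto simp: sp Y_def)
    moreover have "(\<lambda>f. (f, y)) ` \<F> \<subseteq> ?S" using that by auto
    ultimately show ?thesis
      unfolding P by (simp add: measure_point_measure[OF S g] sum.reindex inj_on_def q_def)
  qed
  have "simple_distributed P Y (\<lambda>y. prob (Y -` {y} \<inter> space P))"
    using simple by (rule simple_distributedI) auto
  then have "information_space.entropy_Pow P 2 Y = - (\<Sum>y\<in>Y ` space P. prob (Y -` {y} \<inter> space P) * log 2 (prob (Y -` {y} \<inter> space P)))"
    by (rule entropy_simple_distributed)
  also have "\<dots> = - (\<Sum>y<2 ^ k. q y * log 2 (q y))"
    using q by (simp add: Y_image)
  finally have "information_space.entropy_Pow P 2 Y = - (\<Sum>y<2 ^ k. q y * log 2 (q y))" .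
  \<comment> \<open>The ensemble is indexed by pairs \<open>(f, l)\<close>, with weight
    \<open>p f\<close> and the final amplitudes with unmeasured bits fixed to
    \<open>l\<close>.\<close>
  moreover have "von_neumann_entropy \<rho>\<^sub>Y \<le>
      - (\<Sum>y<2 ^ k. Re (\<rho>\<^sub>Y $$ (y, y)) * log 2 (Re (\<rho>\<^sub>Y $$ (y, y))))"
  proof (rule von_neumann_entropy_le_diagonal)
    show "\<rho>\<^sub>Y \<in> carrier_mat (2 ^ k) (2 ^ k)"
      by (simp add: \<rho>\<^sub>Y_def rho_Y_def partial_trace_def)
    show "0 \<le> (p \<circ> fst) s" if "s \<in> \<F> \<times> {..<2 ^ (n - k) :: nat}" for s
      using that \<open>\<And>f. f \<in> \<F> \<Longrightarrow> 0 \<le> p f\<close> by auto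
    show "\<rho>\<^sub>Y $$ (i, j) = (\<Sum>s\<in>\<F> \<times> {..<2 ^ (n - k)}. complex_of_real ((p \<circ> fst) s) *
        ((\<lambda>(f, l) i. final_vec n m V W \<psi>\<^sub>0 (U f) $ (i * 2 ^ (n - k) + l)) s i *
         cnj ((\<lambda>(f, l) i. final_vec n m V W \<psi>\<^sub>0 (U f) $ (i * 2 ^ (n - k) + l)) s j)))"
      if "i < 2 ^ k" "j < 2 ^ k" for i j
      using rho_Y_index[OF alg U \<psi> that] by (simp add: \<rho>\<^sub>Y_def case_prod_unfold)
  qed
  moreover have "Re (\<rho>\<^sub>Y $$ (y, y)) = q y" if "y < 2 ^ k" for y
    using Re_rho_Y_diag[OF alg U \<psi> that] by (simp add: \<rho>\<^sub>Y_def q_def)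
  ultimately have "von_neumann_entropy \<rho>\<^sub>Y \<le> information_space.entropy_Pow P 2 Y" by simp
  \<comment> \<open>Subtracting the conditional entropy of \<open>Y\<close> given \<open>J\<close>
    from both sides yields the second bound.\<close>
  then show ?thesis
    using mutual_information_eq_entropy_conditional_entropy_swap[OF simple[of J] simple[of Y]] by simp
qed

end
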